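(* Let $\mathbb K$ be an uncountable field, let $A$ be an integral $\mathbb K$-algebra of finite type (an integral domain), let $M$ be a finitely generated torsion free $A$-module, and let $N\ge 0$. Then, with respect to the $\mathrm{Ind}$-Zariski topology, a very general linear partial differential operator in the (infinite dimensional) affine space $DO^N(M,M)$ has kernel zero. Explicitly: for every exhaustion $DO^N(M,M)=\bigcup_{n\in\mathbb N}V_n$ by an increasing sequence of finite dimensional $\mathbb K$-vector subspaces $V_n$ all containing $\mathrm{Id}_M$, and for every $n$, every $D\in V_n$ outside some countable union of proper Zariski-closed subsets of the affine space $V_n$ satisfies $\ker(D)=0$.
   Context: For a $\mathbb K$-algebra $A$ and an $A$-module $M$, $\mathcal J^N(M/\mathbb K)=(A\otimes_{\mathbb K}M)/I^{N+1}(A\otimes_{\mathbb K}M)$ where $I=\ker(A\otimes_{\mathbb K}A\to A)$ is the kernel of multiplication, with $A$-module structure via the first factor, and $d^N:M\to\mathcal J^N(M/\mathbb K)$, $m\mapsto\overline{1\otimes m}$. A differential operator $M\to M$ of order $\le N$ is a map $\widetilde D\circ d^N$ with $\widetilde D:\mathcal J^N(M/\mathbb K)\to M$ $A$-linear; $DO^N(M,M)$ is the $\mathbb K$-vector space of all of these. A finite dimensional $\mathbb K$-vector space is regarded as an affine space over $\mathbb K$ with its Zariski topology. The countable Zariski topology on $V_n$ is the one whose closed sets are the countable unions of Zariski-closed subsets; $DO^N(M,M)$ is given the corresponding inductive limit ($\mathrm{Ind}$) topology. *)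

theory Defs
  imports
    Complex_Main
    "HOL-Algebra.Free_Abelian_Groups"
    "HOL-Algebra.Generated_Groups"
    "HOL-Library.Function_Algebras"
begin

section \<open>Algebras of finite type and their modules\<close>

text \<open>A \<open>K\<close>-algebra \<open>A\<close> is given by its structure map \<open>\<phi> :: 'k \<Rightarrow> 'a\<close>, an \<open>A\<close>-module \<open>M\<close> by its
  scalar multiplication. Integrality of \<open>A\<close> is the class \<open>idom\<close>.\<close>

locale algebra_module = module smul
  for smul :: "'a::idom \<Rightarrow> 'm::ab_group_add \<Rightarrow> 'm" +
  fixes \<phi> :: "'k::field \<Rightarrow> 'a"
  assumes structure_map_one: "\<phi> 1 = 1"
    and structure_map_add: "\<phi> (x + y) = \<phi> x + \<phi> y"
    and structure_map_mult: "\<phi> (x * y) = \<phi> x * \<phi> y"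

inductive_set generated_subalgebra :: "('k::field \<Rightarrow> 'a::comm_ring_1) \<Rightarrow> 'a set \<Rightarrow> 'a set"
  for \<phi> S where
  scalar: "\<phi> c \<in> generated_subalgebra \<phi> S"
| gen: "s \<in> S \<Longrightarrow> s \<in> generated_subalgebra \<phi> S"
| add: "x \<in> generated_subalgebra \<phi> S \<Longrightarrow> y \<in> generated_subalgebra \<phi> S
    \<Longrightarrow> x + y \<in> generated_subalgebra \<phi> S"
| mult: "x \<in> generated_subalgebra \<phi> S \<Longrightarrow> y \<in> generated_subalgebra \<phi> S
    \<Longrightarrow> x * y \<in> generated_subalgebra \<phi> S"

definition finite_type :: "('k::field \<Rightarrow> 'a::comm_ring_1) \<Rightarrow> bool" where
  "finite_type \<phi> \<longleftrightarrow> (\<exists>S. finite S \<and> generated_subalgebra \<phi> S = UNIV)"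

definition finitely_generated_module :: "('a::comm_ring_1 \<Rightarrow> 'm::ab_group_add \<Rightarrow> 'm) \<Rightarrow> bool" where
  "finitely_generated_module smul \<longleftrightarrow> (\<exists>B. finite B \<and> module.span smul B = UNIV)"

definition torsion_free_module :: "('a::idom \<Rightarrow> 'm::ab_group_add \<Rightarrow> 'm) \<Rightarrow> bool" where
  "torsion_free_module smul \<longleftrightarrow> (\<forall>a m. smul a m = 0 \<longrightarrow> a = 0 \<or> m = 0)"


section \<open>Tensor products over the base field\<close>

text \<open>\<open>A \<otimes>\<^sub>K M\<close> is the free abelian group on \<open>A \<times> M\<close> modulo the bilinear, \<open>K\<close>-balanced relations; its
  elements are cosets, and addition is written multiplicatively as the group operation of
  \<open>tensor_product \<phi> smul\<close>. The case \<open>smul = (*)\<close> gives \<open>A \<otimes>\<^sub>K A\<close>.\<close>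

definition tensor_relations ::
  "('k::field \<Rightarrow> 'a::comm_ring_1) \<Rightarrow> ('a \<Rightarrow> 'm::ab_group_add \<Rightarrow> 'm) \<Rightarrow> ('a \<times> 'm \<Rightarrow>\<^sub>0 int) set" where
  "tensor_relations \<phi> smul =
     {frag_of (a + b, m) - frag_of (a, m) - frag_of (b, m) | a b m. True}
   \<union> {frag_of (a, m + n) - frag_of (a, m) - frag_of (a, n) | a m n. True}
   \<union> {frag_of (\<phi> c * a, m) - frag_of (a, smul (\<phi> c) m) | c a m. True}"

definition tensor_null ::
  "('k::field \<Rightarrow> 'a::comm_ring_1) \<Rightarrow> ('a \<Rightarrow> 'm::ab_group_add \<Rightarrow> 'm) \<Rightarrow> ('a \<times> 'm \<Rightarrow>\<^sub>0 int) set" where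
  "tensor_null \<phi> smul = generate (free_Abelian_group UNIV) (tensor_relations \<phi> smul)"

definition tensor_product ::
  "('k::field \<Rightarrow> 'a::comm_ring_1) \<Rightarrow> ('a \<Rightarrow> 'm::ab_group_add \<Rightarrow> 'm)
    \<Rightarrow> ('a \<times> 'm \<Rightarrow>\<^sub>0 int) set monoid" where
  "tensor_product \<phi> smul = free_Abelian_group UNIV Mod tensor_null \<phi> smul"

definition tensor_class ::
  "('k::field \<Rightarrow> 'a::comm_ring_1) \<Rightarrow> ('a \<Rightarrow> 'm::ab_group_add \<Rightarrow> 'm)
    \<Rightarrow> ('a \<times> 'm \<Rightarrow>\<^sub>0 int) \<Rightarrow> ('a \<times> 'm \<Rightarrow>\<^sub>0 int) set" where
  "tensor_class \<phi> smul x = tensor_null \<phi> smul #>\<^bsub>free_Abelian_group UNIV\<^esub> x"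

definition tensor ::
  "('k::field \<Rightarrow> 'a::comm_ring_1) \<Rightarrow> ('a \<Rightarrow> 'm::ab_group_add \<Rightarrow> 'm)
    \<Rightarrow> 'a \<Rightarrow> 'm \<Rightarrow> ('a \<times> 'm \<Rightarrow>\<^sub>0 int) set" where
  "tensor \<phi> smul a m = tensor_class \<phi> smul (frag_of (a, m))"

text \<open>The action \<open>(a \<otimes> b) (c \<otimes> m) = a c \<otimes> b m\<close> of \<open>A \<otimes>\<^sub>K A\<close> on \<open>A \<otimes>\<^sub>K M\<close>, first on formal sums and then
  on cosets (the union below is a single coset); for \<open>smul = (*)\<close> it is the ring
  multiplication of \<open>A \<otimes>\<^sub>K A\<close>.\<close>

definition formal_act ::
  "('a::comm_ring_1 \<Rightarrow> 'm::ab_group_add \<Rightarrow> 'm)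
    \<Rightarrow> ('a \<times> 'a \<Rightarrow>\<^sub>0 int) \<Rightarrow> ('a \<times> 'm \<Rightarrow>\<^sub>0 int) \<Rightarrow> ('a \<times> 'm \<Rightarrow>\<^sub>0 int)" where
  "formal_act smul x y =
     frag_extend (\<lambda>(a, b). frag_extend (\<lambda>(c, m). frag_of (a * c, smul b m)) y) x"

definition tensor_act ::
  "('k::field \<Rightarrow> 'a::comm_ring_1) \<Rightarrow> ('a \<Rightarrow> 'm::ab_group_add \<Rightarrow> 'm)
    \<Rightarrow> ('a \<times> 'a \<Rightarrow>\<^sub>0 int) set \<Rightarrow> ('a \<times> 'm \<Rightarrow>\<^sub>0 int) set \<Rightarrow> ('a \<times> 'm \<Rightarrow>\<^sub>0 int) set" where
  "tensor_act \<phi> smul X Y = (\<Union>x\<in>X. \<Union>y\<in>Y. tensor_class \<phi> smul (formal_act smul x y))"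

definition formal_mult :: "('a::comm_ring_1 \<times> 'a \<Rightarrow>\<^sub>0 int) \<Rightarrow> 'a" where
  "formal_mult x = (\<Sum>(a, b)\<in>Poly_Mapping.keys x. of_int (Poly_Mapping.lookup x (a, b)) * (a * b))"

definition mult_map :: "('a::comm_ring_1 \<times> 'a \<Rightarrow>\<^sub>0 int) set \<Rightarrow> 'a" where
  "mult_map X = the_elem (formal_mult ` X)"


section \<open>Jet modules and differential operators\<close>

definition diagonal_ideal ::
  "('k::field \<Rightarrow> 'a::comm_ring_1) \<Rightarrow> ('a \<times> 'a \<Rightarrow>\<^sub>0 int) set set" where
  "diagonal_ideal \<phi> = {X \<in> carrier (tensor_product \<phi> (*)). mult_map X = 0}"

primrec diagonal_power ::
  "('k::field \<Rightarrow> 'a::comm_ring_1) \<Rightarrow> nat \<Rightarrow> ('a \<times> 'a \<Rightarrow>\<^sub>0 int) set set" where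
  "diagonal_power \<phi> 0 = carrier (tensor_product \<phi> (*))"
| "diagonal_power \<phi> (Suc k) = generate (tensor_product \<phi> (*))
     {tensor_act \<phi> (*) X Y | X Y. X \<in> diagonal_ideal \<phi> \<and> Y \<in> diagonal_power \<phi> k}"

definition jet_null ::
  "('k::field \<Rightarrow> 'a::comm_ring_1) \<Rightarrow> ('a \<Rightarrow> 'm::ab_group_add \<Rightarrow> 'm) \<Rightarrow> nat
    \<Rightarrow> ('a \<times> 'm \<Rightarrow>\<^sub>0 int) set set" where
  "jet_null \<phi> smul N = generate (tensor_product \<phi> smul)
     {tensor_act \<phi> smul X Y | X Y. X \<in> diagonal_power \<phi> (Suc N) \<and> Y \<in> carrier (tensor_product \<phi> smul)}"

definition jet_module ::
  "('k::field \<Rightarrow> 'a::comm_ring_1) \<Rightarrow> ('a \<Rightarrow> 'm::ab_group_add \<Rightarrow> 'm) \<Rightarrow> nat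
    \<Rightarrow> ('a \<times> 'm \<Rightarrow>\<^sub>0 int) set set monoid" where
  "jet_module \<phi> smul N = tensor_product \<phi> smul Mod jet_null \<phi> smul N"

definition jet_class ::
  "('k::field \<Rightarrow> 'a::comm_ring_1) \<Rightarrow> ('a \<Rightarrow> 'm::ab_group_add \<Rightarrow> 'm) \<Rightarrow> nat
    \<Rightarrow> ('a \<times> 'm \<Rightarrow>\<^sub>0 int) set \<Rightarrow> ('a \<times> 'm \<Rightarrow>\<^sub>0 int) set set" where
  "jet_class \<phi> smul N X = jet_null \<phi> smul N #>\<^bsub>tensor_product \<phi> smul\<^esub> X"

text \<open>\<open>A\<close> acts through the first tensor factor, that is, \<open>a\<close> acts as \<open>a \<otimes> 1\<close>.\<close>

definition jet_scale ::
  "('k::field \<Rightarrow> 'a::comm_ring_1) \<Rightarrow> ('a \<Rightarrow> 'm::ab_group_add \<Rightarrow> 'm) \<Rightarrow> nat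
    \<Rightarrow> 'a \<Rightarrow> ('a \<times> 'm \<Rightarrow>\<^sub>0 int) set set \<Rightarrow> ('a \<times> 'm \<Rightarrow>\<^sub>0 int) set set" where
  "jet_scale \<phi> smul N a J =
     (\<Union>X\<in>J. jet_class \<phi> smul N (tensor_act \<phi> smul (tensor \<phi> (*) a 1) X))"

definition universal_derivation ::
  "('k::field \<Rightarrow> 'a::comm_ring_1) \<Rightarrow> ('a \<Rightarrow> 'm::ab_group_add \<Rightarrow> 'm) \<Rightarrow> nat
    \<Rightarrow> 'm \<Rightarrow> ('a \<times> 'm \<Rightarrow>\<^sub>0 int) set set" where
  "universal_derivation \<phi> smul N m = jet_class \<phi> smul N (tensor \<phi> smul 1 m)"

definition jet_linear ::
  "('k::field \<Rightarrow> 'a::comm_ring_1) \<Rightarrow> ('a \<Rightarrow> 'm::ab_group_add \<Rightarrow> 'm) \<Rightarrow> nat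
    \<Rightarrow> (('a \<times> 'm \<Rightarrow>\<^sub>0 int) set set \<Rightarrow> 'm) \<Rightarrow> bool" where
  "jet_linear \<phi> smul N L \<longleftrightarrow>
     (\<forall>X\<in>carrier (jet_module \<phi> smul N). \<forall>Y\<in>carrier (jet_module \<phi> smul N).
        L (X \<otimes>\<^bsub>jet_module \<phi> smul N\<^esub> Y) = L X + L Y) \<and>
     (\<forall>a. \<forall>X\<in>carrier (jet_module \<phi> smul N). L (jet_scale \<phi> smul N a X) = smul a (L X))"

definition differential_operators ::
  "('k::field \<Rightarrow> 'a::comm_ring_1) \<Rightarrow> ('a \<Rightarrow> 'm::ab_group_add \<Rightarrow> 'm) \<Rightarrow> nat \<Rightarrow> ('m \<Rightarrow> 'm) set" where
  "differential_operators \<phi> smul N =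
     {L \<circ> universal_derivation \<phi> smul N | L. jet_linear \<phi> smul N L}"

definition operator_scale ::
  "('k::field \<Rightarrow> 'a::comm_ring_1) \<Rightarrow> ('a \<Rightarrow> 'm::ab_group_add \<Rightarrow> 'm)
    \<Rightarrow> 'k \<Rightarrow> ('m \<Rightarrow> 'm) \<Rightarrow> ('m \<Rightarrow> 'm)" where
  "operator_scale \<phi> smul c D = (\<lambda>m. smul (\<phi> c) (D m))"


section \<open>Zariski, countable Zariski and Ind-Zariski topologies\<close>

definition finite_dimensional_subspace ::
  "('k::field \<Rightarrow> 'v::ab_group_add \<Rightarrow> 'v) \<Rightarrow> 'v set \<Rightarrow> bool" where
  "finite_dimensional_subspace scale V \<longleftrightarrow>
     module.subspace scale V \<and> (\<exists>B. finite B \<and> module.span scale B = V)"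

text \<open>The algebra of polynomial functions on \<open>V\<close>, generated by the linear forms. Functions are total on
  the ambient type; only their values on \<open>V\<close> matter.\<close>

inductive_set polynomial_functions ::
  "('k::field \<Rightarrow> 'v::ab_group_add \<Rightarrow> 'v) \<Rightarrow> 'v set \<Rightarrow> ('v \<Rightarrow> 'k) set"
  for scale V where
  const: "(\<lambda>_. c) \<in> polynomial_functions scale V"
| linear_form: "(\<And>x y. x \<in> V \<Longrightarrow> y \<in> V \<Longrightarrow> l (x + y) = l x + l y)
    \<Longrightarrow> (\<And>c x. x \<in> V \<Longrightarrow> l (scale c x) = c * l x) \<Longrightarrow> l \<in> polynomial_functions scale V"
| add: "p \<in> polynomial_functions scale V \<Longrightarrow> q \<in> polynomial_functions scale V
    \<Longrightarrow> (\<lambda>x. p x + q x) \<in> polynomial_functions scale V"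
| mult: "p \<in> polynomial_functions scale V \<Longrightarrow> q \<in> polynomial_functions scale V
    \<Longrightarrow> (\<lambda>x. p x * q x) \<in> polynomial_functions scale V"

definition zariski_closed ::
  "('k::field \<Rightarrow> 'v::ab_group_add \<Rightarrow> 'v) \<Rightarrow> 'v set \<Rightarrow> 'v set \<Rightarrow> bool" where
  "zariski_closed scale V C \<longleftrightarrow>
     (\<exists>P \<subseteq> polynomial_functions scale V. C = {x \<in> V. \<forall>p\<in>P. p x = 0})"

definition countable_zariski_closed ::
  "('k::field \<Rightarrow> 'v::ab_group_add \<Rightarrow> 'v) \<Rightarrow> 'v set \<Rightarrow> 'v set \<Rightarrow> bool" where
  "countable_zariski_closed scale V Z \<longleftrightarrow>
     (\<exists>\<C>. countable \<C> \<and> (\<forall>C\<in>\<C>. zariski_closed scale V C) \<and> Z = \<Union>\<C>)"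

text \<open>Closed sets of the inductive limit topology on \<open>\<Union>n. V n\<close>, each \<open>V n\<close> carrying the countable
  Zariski topology.\<close>

definition ind_zariski_closed ::
  "('k::field \<Rightarrow> 'v::ab_group_add \<Rightarrow> 'v) \<Rightarrow> (nat \<Rightarrow> 'v set) \<Rightarrow> 'v set \<Rightarrow> bool" where
  "ind_zariski_closed scale V Z \<longleftrightarrow>
     Z \<subseteq> (\<Union>n. V n) \<and> (\<forall>n. countable_zariski_closed scale (V n) (Z \<inter> V n))"

text \<open>Properness is required of each member of the countable family, for every \<open>n\<close>; it is not derived
  from \<open>Z \<inter> V n \<noteq> V n\<close>.\<close>

definition very_general ::
  "('k::field \<Rightarrow> 'v::ab_group_add \<Rightarrow> 'v) \<Rightarrow> (nat \<Rightarrow> 'v set) \<Rightarrow> ('v \<Rightarrow> bool) \<Rightarrow> bool" where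
  "very_general scale V P \<longleftrightarrow>
     (\<exists>Z. ind_zariski_closed scale V Z \<and>
       (\<forall>n. \<exists>\<C>. countable \<C> \<and> (\<forall>C\<in>\<C>. zariski_closed scale (V n) C \<and> C \<noteq> V n) \<and> Z \<inter> V n = \<Union>\<C>) \<and>
       (\<forall>x \<in> (\<Union>n. V n) - Z. P x))"

end

theory Submission
  imports Defs "Jordan_Normal_Form.Determinant"
begin

text \<open>A differential operator is linear over the base field \<open>K\<close>, and \<open>M\<close> has a countable \<open>K\<close>-basis \<open>B\<close>. So
  \<open>D\<close> has a nonzero kernel iff the vectors \<open>D w\<close>, \<open>w \<in> F\<close>, are linearly dependent for one of the countably
  many finite \<open>F \<subseteq> B\<close>. For fixed \<open>F\<close> this is the vanishing of minors, a Zariski-closed condition on \<open>D\<close>,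
  and it fails for \<open>D = id\<close>; hence it cuts out a proper closed subset of each \<open>V n\<close>.\<close>

section \<open>Differential operators are linear over the base field\<close>

context algebra_module
begin

text \<open>Lets every fact about \<open>A \<otimes>\<^sub>K M\<close> be reused for
  \<open>A \<otimes>\<^sub>K A\<close>, where the diagonal ideal and its powers live.\<close>

lemma algebra_module_self: "algebra_module (*) \<phi>"
  by unfold_locales
    (auto simp: algebra_simps structure_map_one structure_map_add structure_map_mult)

lemma vector_space_over_base: "vector_space (\<lambda>c. smul (\<phi> c))"
  by unfold_locales
    (auto simp: scale_right_distrib scale_left_distrib structure_map_add structure_map_mult
      structure_map_one)

lemma subgroup_tensor_null: "subgroup (tensor_null \<phi> smul) (free_Abelian_group UNIV)"
  unfolding tensor_null_def by (rule group.generate_is_subgroup) auto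

lemma normal_tensor_null: "tensor_null \<phi> smul \<lhd> free_Abelian_group UNIV"
  by (rule comm_group.subgroup_imp_normal[OF abelian_free_Abelian_group subgroup_tensor_null])

lemma tensor_null_zero: "0 \<in> tensor_null \<phi> smul"
  using subgroup.one_closed[OF subgroup_tensor_null] by simp

lemma tensor_null_add:
  "x \<in> tensor_null \<phi> smul \<Longrightarrow> y \<in> tensor_null \<phi> smul \<Longrightarrow> x + y \<in> tensor_null \<phi> smul"
  using subgroup.m_closed[OF subgroup_tensor_null, of x y] by simp

lemma tensor_null_minus: "x \<in> tensor_null \<phi> smul \<Longrightarrow> - x \<in> tensor_null \<phi> smul"
  using subgroup.m_inv_closed[OF subgroup_tensor_null, of x] by simp

lemma tensor_null_diff:
  "x \<in> tensor_null \<phi> smul \<Longrightarrow> y \<in> tensor_null \<phi> smul \<Longrightarrow> x - y \<in> tensor_null \<phi> smul"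
  using tensor_null_add[of x "- y"] tensor_null_minus[of y] by simp

lemma tensor_null_relation: "x \<in> tensor_relations \<phi> smul \<Longrightarrow> x \<in> tensor_null \<phi> smul"
  unfolding tensor_null_def by (rule generate.incl)

text \<open>Additive form of the induction for \<open>generate\<close>: a property stable under the
  group operations needs checking on the defining relations only.\<close>

lemma tensor_null_induct [consumes 1, case_names relation zero minus add]:
  assumes "x \<in> tensor_null \<phi> smul"
    and "\<And>r. r \<in> tensor_relations \<phi> smul \<Longrightarrow> P r" and "P 0"
    and "\<And>x. P x \<Longrightarrow> P (- x)" and "\<And>x y. P x \<Longrightarrow> P y \<Longrightarrow> P (x + y)"
  shows "P x"
  using assms(1) unfolding tensor_null_def
  by induction (auto simp: assms(2-5))

lemma comm_group_tensor_product: "comm_group (tensor_product \<phi> smul)"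
  unfolding tensor_product_def
  by (rule comm_group.abelian_FactGroup[OF abelian_free_Abelian_group subgroup_tensor_null])

lemma tensor_class_in_carrier: "tensor_class \<phi> smul x \<in> carrier (tensor_product \<phi> smul)"
  unfolding tensor_product_def tensor_class_def FactGroup_def RCOSETS_def by auto

lemma tensor_product_cases:
  assumes "X \<in> carrier (tensor_product \<phi> smul)"
  obtains x where "X = tensor_class \<phi> smul x"
  using assms unfolding tensor_product_def tensor_class_def FactGroup_def RCOSETS_def by auto

lemma tensor_class_mult:
  "tensor_class \<phi> smul x \<otimes>\<^bsub>tensor_product \<phi> smul\<^esub> tensor_class \<phi> smul y = tensor_class \<phi> smul (x + y)"
  using normal.rcos_sum[OF normal_tensor_null, of x y]
  by (simp add: tensor_class_def tensor_product_def FactGroup_def)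

text \<open>Replaces cosets by congruences between formal sums.\<close>

lemma mem_tensor_class_iff: "x \<in> tensor_class \<phi> smul y \<longleftrightarrow> x - y \<in> tensor_null \<phi> smul"
  unfolding tensor_class_def r_coset_def by (auto simp: algebra_simps intro: bexI[of _ "x - y"])

lemma tensor_class_eqI:
  assumes "x - y \<in> tensor_null \<phi> smul"
  shows "tensor_class \<phi> smul x = tensor_class \<phi> smul y"
proof -
  have "z - x \<in> tensor_null \<phi> smul \<longleftrightarrow> z - y \<in> tensor_null \<phi> smul" for z
    using tensor_null_add[OF _ assms, of "z - x"] tensor_null_diff[OF _ assms, of "z - y"] by auto
  then show ?thesis
    by (auto simp: mem_tensor_class_iff)
qed

end

section \<open>The action on formal sums is biadditive\<close>

lemma frag_extend_plus_fun: "frag_extend (\<lambda>i. f i + g i) x = frag_extend f x + frag_extend g x"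
  by (simp add: frag_extend_def frag_cmul_distrib2 sum.distrib)

lemma frag_extend_uminus_fun: "frag_extend (\<lambda>i. - f i) x = - frag_extend f x"
  by (rule frag_induction[of x UNIV]) (auto simp: frag_extend_diff)

lemma formal_act_zero_left [simp]: "formal_act smul 0 y = 0"
  by (simp add: formal_act_def)

lemma formal_act_zero_right [simp]: "formal_act smul x 0 = 0"
  by (simp add: formal_act_def frag_extend_eq_0 case_prod_beta)

lemma formal_act_add_left: "formal_act smul (x + x') y = formal_act smul x y + formal_act smul x' y"
  by (simp add: formal_act_def frag_extend_add)

lemma formal_act_minus_left: "formal_act smul (- x) y = - formal_act smul x y"
  by (simp add: formal_act_def frag_extend_minus)

lemma formal_act_diff_left: "formal_act smul (x - x') y = formal_act smul x y - formal_act smul x' y"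
  by (simp add: formal_act_def frag_extend_diff)

text \<open>The second slot sits inside the outer \<open>frag_extend\<close>, so additivity of
  \<open>frag_extend\<close> in its function argument is used as well.\<close>

lemma formal_act_add_right: "formal_act smul x (y + y') = formal_act smul x y + formal_act smul x y'"
  by (simp add: formal_act_def frag_extend_add case_prod_beta' frag_extend_plus_fun)

lemma formal_act_minus_right: "formal_act smul x (- y) = - formal_act smul x y"
  by (simp add: formal_act_def frag_extend_minus case_prod_beta' frag_extend_uminus_fun)

lemma formal_act_diff_right: "formal_act smul x (y - y') = formal_act smul x y - formal_act smul x y'"
  using formal_act_add_right[of smul x y "- y'"] by (simp add: formal_act_minus_right)

lemma formal_act_frag_of [simp]:
  "formal_act smul (frag_of (a, b)) (frag_of (c, m)) = frag_of (a * c, smul b m)"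
  by (simp add: formal_act_def)

text \<open>Exposes basis elements as explicit pairs, the shape on which
  \<open>formal_act_frag_of\<close> computes.\<close>

lemma frag_pair_induct [case_names zero frag_of diff]:
  fixes x :: "'x \<times> 'y \<Rightarrow>\<^sub>0 int"
  assumes "P 0" and "\<And>a b. P (frag_of (a, b))" and "\<And>x y. P x \<Longrightarrow> P y \<Longrightarrow> P (x - y)"
  shows "P x"
  by (rule frag_induction[of x UNIV]) (use assms in auto)

section \<open>The action descends to tensor classes\<close>

context algebra_module
begin

text \<open>By additivity \<open>y\<close> may be a basis element \<open>(c, m)\<close>. It carries
  each kind of relation of \<open>A \<otimes>\<^sub>K A\<close> to a relation of the same kind in
  \<open>A \<otimes>\<^sub>K M\<close>; the balanced kind uses associativity.\<close>

lemma formal_act_relation_left: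
  assumes "r \<in> tensor_relations \<phi> (*)"
  shows "formal_act smul r y \<in> tensor_null \<phi> smul"
proof (induction y rule: frag_pair_induct)
  case zero
  show ?case by (simp add: tensor_null_zero)
next
  case (diff x y)
  then show ?case by (simp add: formal_act_diff_right tensor_null_diff)
next
  case (frag_of c m)
  have "frag_of (\<phi> k * a * c, smul b m) - frag_of (a * c, smul (\<phi> k * b) m)
      \<in> tensor_relations \<phi> smul" for k a b
  proof -
    have "frag_of (\<phi> k * (a * c), smul b m) - frag_of (a * c, smul (\<phi> k) (smul b m))
        \<in> tensor_relations \<phi> smul"
      unfolding tensor_relations_def by blast
    then show ?thesis by (simp add: mult_ac)
  qed
  moreover have "frag_of ((a + a') * c, smul b m) - frag_of (a * c, smul b m) - frag_of (a' * c, smul b m)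
      \<in> tensor_relations \<phi> smul" for a a' b
    unfolding tensor_relations_def distrib_right by blast
  moreover have "frag_of (a * c, smul (b + b') m) - frag_of (a * c, smul b m) - frag_of (a * c, smul b' m)
      \<in> tensor_relations \<phi> smul" for a b b'
    unfolding tensor_relations_def scale_left_distrib by blast
  ultimately have "formal_act smul r (frag_of (c, m)) \<in> tensor_relations \<phi> smul"
    using assms unfolding tensor_relations_def[of _ "(*)"]
    by (elim UnE CollectE exE conjE) (simp_all add: formal_act_diff_left del: scale_scale)
  then show ?case by (rule tensor_null_relation)
qed

text \<open>Again relations go to relations of the same kind. The balanced kind survives because
  \<open>\<phi> c\<close> commutes with \<open>a\<close> and with the action of
  \<open>b\<close>.\<close>

lemma formal_act_relation_right:
  assumes "r \<in> tensor_relations \<phi> smul"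
  shows "formal_act smul x r \<in> tensor_null \<phi> smul"
proof (induction x rule: frag_pair_induct)
  case zero
  show ?case by (simp add: tensor_null_zero)
next
  case (diff x y)
  then show ?case by (simp add: formal_act_diff_left tensor_null_diff)
next
  case (frag_of a b)
  have "frag_of (a * (\<phi> c * d), smul b m) - frag_of (a * d, smul b (smul (\<phi> c) m))
      \<in> tensor_relations \<phi> smul" for c d m
  proof -
    have "frag_of (\<phi> c * (a * d), smul b m) - frag_of (a * d, smul (\<phi> c) (smul b m))
        \<in> tensor_relations \<phi> smul"
      unfolding tensor_relations_def by blast
    then show ?thesis by (simp add: mult_ac)
  qed
  moreover have "frag_of (a * (c + c'), smul b m) - frag_of (a * c, smul b m) - frag_of (a * c', smul b m)
      \<in> tensor_relations \<phi> smul" for c c' m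
    unfolding tensor_relations_def distrib_left by blast
  moreover have "frag_of (a * c, smul b (m + m')) - frag_of (a * c, smul b m) - frag_of (a * c, smul b m')
      \<in> tensor_relations \<phi> smul" for c m m'
    unfolding tensor_relations_def scale_right_distrib by blast
  ultimately have "formal_act smul (frag_of (a, b)) r \<in> tensor_relations \<phi> smul"
    \<comment> \<open>Only the membership of \<open>r\<close> is unfolded, so that the goal, about
      the same set, still matches the facts above.\<close>
    using assms unfolding tensor_relations_def[of \<phi> smul, THEN eqset_imp_iff, of r]
    by (elim UnE CollectE exE conjE) (simp_all add: formal_act_diff_right del: scale_scale)
  then show ?case by (rule tensor_null_relation)
qed

lemma formal_act_null_left:
  "x \<in> tensor_null \<phi> (*) \<Longrightarrow> formal_act smul x y \<in> tensor_null \<phi> smul"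
  by (induction rule: algebra_module.tensor_null_induct[OF algebra_module_self, consumes 1])
    (auto simp: formal_act_relation_left tensor_null_zero formal_act_minus_left tensor_null_minus
      formal_act_add_left tensor_null_add)

lemma formal_act_null_right:
  "y \<in> tensor_null \<phi> smul \<Longrightarrow> formal_act smul x y \<in> tensor_null \<phi> smul"
  by (induction rule: tensor_null_induct)
    (auto simp: formal_act_relation_right tensor_null_zero formal_act_minus_right tensor_null_minus
      formal_act_add_right tensor_null_add)

text \<open>The union defining \<open>tensor_act\<close> runs over all representatives: they all
  give the same coset, and at least one pair of representatives exists.\<close>

lemma tensor_act_class:
  "tensor_act \<phi> smul (tensor_class \<phi> (*) x) (tensor_class \<phi> smul y)
    = tensor_class \<phi> smul (formal_act smul x y)"
proof -
  interpret self: algebra_module "(*)" \<phi> by (rule algebra_module_self)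
  have "tensor_class \<phi> smul (formal_act smul x' y') = tensor_class \<phi> smul (formal_act smul x y)"
    if "x' \<in> tensor_class \<phi> (*) x" "y' \<in> tensor_class \<phi> smul y" for x' y'
  proof (rule tensor_class_eqI)
    \<comment> \<open>The representatives are changed one at a time.\<close>
    have "formal_act smul x' y' - formal_act smul x y
        = formal_act smul (x' - x) y' + formal_act smul x (y' - y)"
      by (simp add: formal_act_diff_left formal_act_diff_right)
    then show "formal_act smul x' y' - formal_act smul x y \<in> tensor_null \<phi> smul"
      using that
      by (simp add: mem_tensor_class_iff self.mem_tensor_class_iff formal_act_null_left
          formal_act_null_right tensor_null_add)
  qed
  moreover have "x \<in> tensor_class \<phi> (*) x" "y \<in> tensor_class \<phi> smul y"
    by (simp_all add: mem_tensor_class_iff self.mem_tensor_class_iff tensor_null_zero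
        self.tensor_null_zero)
  ultimately show ?thesis
    unfolding tensor_act_def by blast
qed

lemma tensor_act_closed:
  assumes "X \<in> carrier (tensor_product \<phi> (*))" "Y \<in> carrier (tensor_product \<phi> smul)"
  shows "tensor_act \<phi> smul X Y \<in> carrier (tensor_product \<phi> smul)"
  using assms
  by (metis algebra_module.tensor_product_cases algebra_module_self tensor_product_cases
      tensor_act_class tensor_class_in_carrier)

lemma tensor_act_hom:
  assumes "X \<in> carrier (tensor_product \<phi> (*))"
  shows "group_hom (tensor_product \<phi> smul) (tensor_product \<phi> smul) (tensor_act \<phi> smul X)"
proof -
  interpret T: comm_group "tensor_product \<phi> smul" by (rule comm_group_tensor_product)
  show ?thesis
  proof
    show "tensor_act \<phi> smul X \<in> hom (tensor_product \<phi> smul) (tensor_product \<phi> smul)"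
    proof (rule homI)
      show "tensor_act \<phi> smul X Y \<in> carrier (tensor_product \<phi> smul)"
        if "Y \<in> carrier (tensor_product \<phi> smul)" for Y
        using assms that by (rule tensor_act_closed)
      fix Y Z
      assume "Y \<in> carrier (tensor_product \<phi> smul)" "Z \<in> carrier (tensor_product \<phi> smul)"
      moreover obtain x where "X = tensor_class \<phi> (*) x"
        using algebra_module.tensor_product_cases[OF algebra_module_self assms] by blast
      ultimately show "tensor_act \<phi> smul X (Y \<otimes>\<^bsub>tensor_product \<phi> smul\<^esub> Z)
          = tensor_act \<phi> smul X Y \<otimes>\<^bsub>tensor_product \<phi> smul\<^esub> tensor_act \<phi> smul X Z"
        by (elim tensor_product_cases)
          (simp add: tensor_class_mult tensor_act_class formal_act_add_right)
    qed
  qed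
qed

text \<open>On basis elements both sides are the pair \<open>(a * c * e, b d m)\<close>, by
  commutativity of \<open>A\<close>; the equality holds before any relation is imposed.\<close>

lemma formal_act_left_commute:
  "formal_act smul x (formal_act smul y z) = formal_act smul y (formal_act smul x z)"
proof (induction x rule: frag_pair_induct)
  case (frag_of a b)
  show ?case
  proof (induction y rule: frag_pair_induct)
    case (frag_of c d)
    show ?case
    proof (induction z rule: frag_pair_induct)
      case (frag_of e m)
      show ?case by (simp add: mult_ac)
    qed (auto simp: formal_act_diff_right)
  qed (auto simp: formal_act_diff_left formal_act_diff_right)
qed (auto simp: formal_act_diff_left formal_act_diff_right)

lemma tensor_act_left_commute:
  assumes "X \<in> carrier (tensor_product \<phi> (*))" "Y \<in> carrier (tensor_product \<phi> (*))"
    and "Z \<in> carrier (tensor_product \<phi> smul)"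
  shows "tensor_act \<phi> smul X (tensor_act \<phi> smul Y Z) = tensor_act \<phi> smul Y (tensor_act \<phi> smul X Z)"
proof -
  interpret self: algebra_module "(*)" \<phi> by (rule algebra_module_self)
  show ?thesis
    using assms
    by (elim tensor_product_cases self.tensor_product_cases)
      (simp add: tensor_act_class formal_act_left_commute)
qed

section \<open>Powers of the diagonal ideal and the jet module\<close>

lemma diagonal_power_subset: "diagonal_power \<phi> k \<subseteq> carrier (tensor_product \<phi> (*))"
proof (induction k)
  case (Suc k)
  interpret self: algebra_module "(*)" \<phi> by (rule algebra_module_self)
  interpret T: comm_group "tensor_product \<phi> (*)" by (rule self.comm_group_tensor_product)
  have "{tensor_act \<phi> (*) X Y | X Y. X \<in> diagonal_ideal \<phi> \<and> Y \<in> diagonal_power \<phi> k}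
      \<subseteq> carrier (tensor_product \<phi> (*))"
    using Suc by (auto simp: diagonal_ideal_def intro!: self.tensor_act_closed)
  then show ?case
    using T.generate_incl by simp
qed simp

lemma jet_generators_subset:
  "{tensor_act \<phi> smul X Y | X Y. X \<in> diagonal_power \<phi> (Suc N) \<and> Y \<in> carrier (tensor_product \<phi> smul)}
    \<subseteq> carrier (tensor_product \<phi> smul)"
  using diagonal_power_subset[of "Suc N"] by (auto intro!: tensor_act_closed simp del: diagonal_power.simps)

lemma subgroup_jet_null: "subgroup (jet_null \<phi> smul N) (tensor_product \<phi> smul)"
  unfolding jet_null_def
  by (rule group.generate_is_subgroup[OF comm_group.axioms(2)[OF comm_group_tensor_product]
        jet_generators_subset])

lemma normal_jet_null: "jet_null \<phi> smul N \<lhd> tensor_product \<phi> smul"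
  by (rule comm_group.subgroup_imp_normal[OF comm_group_tensor_product subgroup_jet_null])

text \<open>Since \<open>X (P Z) = P (X Z)\<close>, generators go to generators, and the
  homomorphism property extends this to the generated subgroup. This is what makes the
  \<open>A\<close>-action on jets well defined.\<close>

lemma tensor_act_jet_null:
  assumes X: "X \<in> carrier (tensor_product \<phi> (*))" and "Y \<in> jet_null \<phi> smul N"
  shows "tensor_act \<phi> smul X Y \<in> jet_null \<phi> smul N"
proof -
  let ?T = "tensor_product \<phi> smul"
  let ?G = "{tensor_act \<phi> smul X Y | X Y. X \<in> diagonal_power \<phi> (Suc N) \<and> Y \<in> carrier ?T}"
  interpret h: group_hom ?T ?T "tensor_act \<phi> smul X" by (rule tensor_act_hom[OF X])
  have gen: "tensor_act \<phi> smul X h \<in> ?G" if hG: "h \<in> ?G" for h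
  proof -
    obtain P Z where h: "h = tensor_act \<phi> smul P Z" "P \<in> diagonal_power \<phi> (Suc N)" "Z \<in> carrier ?T"
      using hG by blast
    have "tensor_act \<phi> smul X h = tensor_act \<phi> smul P (tensor_act \<phi> smul X Z)"
      unfolding h(1) using X h diagonal_power_subset[of "Suc N"]
      by (intro tensor_act_left_commute) (auto simp del: diagonal_power.simps)
    then show ?thesis
      using h X tensor_act_closed by blast
  qed
  have sub: "generate ?T ?G \<subseteq> carrier ?T"
    by (rule h.G.generate_incl[OF jet_generators_subset])
  show ?thesis
    using assms(2) unfolding jet_null_def
  proof induction
    case one
    then show ?case by (simp add: generate.one)
  next
    case (incl h)
    then show ?case using gen[OF incl] by (rule_tac generate.incl)
  next
    case (inv h)
    then have "h \<in> carrier ?T" using jet_generators_subset by blast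
    then show ?case using generate.inv[OF gen[OF inv]] by simp
  next
    case (eng h1 h2)
    then show ?case using sub by (simp add: subset_iff generate.eng)
  qed
qed

lemma jet_class_mult:
  assumes "X \<in> carrier (tensor_product \<phi> smul)" "Y \<in> carrier (tensor_product \<phi> smul)"
  shows "jet_class \<phi> smul N X \<otimes>\<^bsub>jet_module \<phi> smul N\<^esub> jet_class \<phi> smul N Y
    = jet_class \<phi> smul N (X \<otimes>\<^bsub>tensor_product \<phi> smul\<^esub> Y)"
  using normal.rcos_sum[OF normal_jet_null assms]
  by (simp add: jet_class_def jet_module_def FactGroup_def)

lemma jet_class_in_carrier:
  "X \<in> carrier (tensor_product \<phi> smul) \<Longrightarrow> jet_class \<phi> smul N X \<in> carrier (jet_module \<phi> smul N)"
  unfolding jet_class_def jet_module_def FactGroup_def RCOSETS_def by auto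

lemma jet_class_absorb:
  assumes "Y \<in> jet_null \<phi> smul N" "X \<in> carrier (tensor_product \<phi> smul)"
  shows "jet_class \<phi> smul N (Y \<otimes>\<^bsub>tensor_product \<phi> smul\<^esub> X) = jet_class \<phi> smul N X"
proof -
  interpret T: comm_group "tensor_product \<phi> smul" by (rule comm_group_tensor_product)
  have "Y \<otimes>\<^bsub>tensor_product \<phi> smul\<^esub> X \<in> jet_null \<phi> smul N #>\<^bsub>tensor_product \<phi> smul\<^esub> X"
    using assms by (auto simp: r_coset_def)
  then show ?thesis
    unfolding jet_class_def using T.repr_independence assms(2) subgroup_jet_null by metis
qed

text \<open>Changing the representative by an element of \<open>jet_null\<close> changes its image
  by an element of \<open>jet_null\<close>, so the union in \<open>jet_scale\<close> is a single
  coset.\<close>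

lemma jet_scale_class:
  assumes X: "X \<in> carrier (tensor_product \<phi> smul)"
  shows "jet_scale \<phi> smul N a (jet_class \<phi> smul N X)
    = jet_class \<phi> smul N (tensor_act \<phi> smul (tensor \<phi> (*) a 1) X)"
proof -
  let ?T = "tensor_product \<phi> smul"
  let ?A = "tensor \<phi> (*) a 1"
  have A: "?A \<in> carrier (tensor_product \<phi> (*))"
    unfolding tensor_def by (rule algebra_module.tensor_class_in_carrier[OF algebra_module_self])
  interpret h: group_hom ?T ?T "tensor_act \<phi> smul ?A" by (rule tensor_act_hom[OF A])
  have "jet_class \<phi> smul N (tensor_act \<phi> smul ?A (Y \<otimes>\<^bsub>?T\<^esub> X))
      = jet_class \<phi> smul N (tensor_act \<phi> smul ?A X)" if Y: "Y \<in> jet_null \<phi> smul N" for Y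
    using subgroup.mem_carrier[OF subgroup_jet_null Y] X tensor_act_jet_null[OF A Y]
    by (simp add: jet_class_absorb)
  moreover have "jet_null \<phi> smul N \<noteq> {}"
    using subgroup.one_closed[OF subgroup_jet_null] by blast
  ultimately show ?thesis
    unfolding jet_scale_def by (auto simp: jet_class_def[of _ _ _ X] r_coset_def)
qed

section \<open>The universal derivation and linearity over \<open>K\<close>\<close>

lemma tensor_in_carrier: "tensor \<phi> smul a m \<in> carrier (tensor_product \<phi> smul)"
  unfolding tensor_def by (rule tensor_class_in_carrier)

lemma tensor_add_right:
  "tensor \<phi> smul a (m + n) = tensor \<phi> smul a m \<otimes>\<^bsub>tensor_product \<phi> smul\<^esub> tensor \<phi> smul a n"
  unfolding tensor_def tensor_class_mult
proof (rule tensor_class_eqI, rule tensor_null_relation)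
  show "frag_of (a, m + n) - (frag_of (a, m) + frag_of (a, n)) \<in> tensor_relations \<phi> smul"
    unfolding tensor_relations_def diff_diff_eq[symmetric] by blast
qed

lemma tensor_balanced: "tensor \<phi> smul (\<phi> c * a) m = tensor \<phi> smul a (smul (\<phi> c) m)"
  unfolding tensor_def
  by (rule tensor_class_eqI, rule tensor_null_relation) (unfold tensor_relations_def, blast)

lemma universal_derivation_in_carrier:
  "universal_derivation \<phi> smul N m \<in> carrier (jet_module \<phi> smul N)"
  unfolding universal_derivation_def by (rule jet_class_in_carrier[OF tensor_in_carrier])

lemma universal_derivation_add:
  "universal_derivation \<phi> smul N (m + n) = universal_derivation \<phi> smul N m
    \<otimes>\<^bsub>jet_module \<phi> smul N\<^esub> universal_derivation \<phi> smul N n"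
  by (simp add: universal_derivation_def jet_class_mult tensor_in_carrier tensor_add_right)

text \<open>Scalars from \<open>K\<close> pass between the factors,
  \<open>1 \<otimes> c m = c \<otimes> m\<close>, and the \<open>A\<close>-structure of the jets is
  that of the first factor.\<close>

lemma universal_derivation_scale:
  "universal_derivation \<phi> smul N (smul (\<phi> c) m)
    = jet_scale \<phi> smul N (\<phi> c) (universal_derivation \<phi> smul N m)"
proof -
  have "tensor_act \<phi> smul (tensor \<phi> (*) (\<phi> c) 1) (tensor \<phi> smul 1 m) = tensor \<phi> smul (\<phi> c) m"
    unfolding tensor_def by (simp add: tensor_act_class)
  then show ?thesis
    using tensor_balanced[of c 1 m]
    by (simp add: universal_derivation_def jet_scale_class tensor_in_carrier)
qed

text \<open>An \<open>A\<close>-linear map on jets composed with the \<open>K\<close>-linear map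
  \<open>universal_derivation\<close>. From here on operators are treated just as
  \<open>K\<close>-linear maps.\<close>

lemma differential_operator_linear:
  assumes "D \<in> differential_operators \<phi> smul N"
  shows "Vector_Spaces.linear (\<lambda>c. smul (\<phi> c)) (\<lambda>c. smul (\<phi> c)) D"
proof -
  interpret K: vector_space "\<lambda>c. smul (\<phi> c)" by (rule vector_space_over_base)
  obtain L where "D = L \<circ> universal_derivation \<phi> smul N" "jet_linear \<phi> smul N L"
    using assms unfolding differential_operators_def by blast
  then show ?thesis
    by unfold_locales
      (auto simp: jet_linear_def universal_derivation_in_carrier universal_derivation_add
        universal_derivation_scale)
qed

end


section \<open>Failure of injectivity as a countable union of closed conditions\<close>

lemma polynomial_functions_sum:
  "finite I \<Longrightarrow> (\<And>i. i \<in> I \<Longrightarrow> p i \<in> polynomial_functions scale V)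
    \<Longrightarrow> (\<lambda>x. \<Sum>i\<in>I. p i x) \<in> polynomial_functions scale V"
  by (induction I rule: finite_induct)
    (auto intro: polynomial_functions.const polynomial_functions.add)

lemma polynomial_functions_prod:
  "finite I \<Longrightarrow> (\<And>i. i \<in> I \<Longrightarrow> p i \<in> polynomial_functions scale V)
    \<Longrightarrow> (\<lambda>x. \<Prod>i\<in>I. p i x) \<in> polynomial_functions scale V"
  by (induction I rule: finite_induct)
    (auto intro: polynomial_functions.const polynomial_functions.mult)

lemma polynomial_functions_det:
  assumes "\<And>i j. i < r \<Longrightarrow> j < r \<Longrightarrow> p i j \<in> polynomial_functions scale V"
  shows "(\<lambda>x. det (mat r r (\<lambda>(i, j). p i j x))) \<in> polynomial_functions scale V"
proof -
  have "(\<lambda>x. \<Sum>\<sigma> \<in> {\<sigma>. \<sigma> permutes {0..<r}}. signof \<sigma> * (\<Prod>i = 0..<r. p i (\<sigma> i) x))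
      \<in> polynomial_functions scale V"
  proof (intro polynomial_functions_sum polynomial_functions.mult polynomial_functions.const
      polynomial_functions_prod)
    show "p i (\<sigma> i) \<in> polynomial_functions scale V"
      if "\<sigma> \<in> {\<sigma>. \<sigma> permutes {0..<r}}" "i \<in> {0..<r}" for \<sigma> i
      \<comment> \<open>Entries are known to be polynomial only for indices below \<open>r\<close>,
        so \<open>\<sigma> i\<close> has to stay in range.\<close>
      using that permutes_in_image[of \<sigma> "{0..<r}" i] by (auto intro: assms)
  qed (auto simp: finite_permutations)
  moreover have "det (mat r r (\<lambda>(i, j). p i j x))
      = (\<Sum>\<sigma> \<in> {\<sigma>. \<sigma> permutes {0..<r}}. signof \<sigma> * (\<Prod>i = 0..<r. p i (\<sigma> i) x))" for x
    unfolding det_def using permutes_in_image[of _ "{0..<r}"]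
    by (auto intro!: sum.cong prod.cong)
  ultimately show ?thesis by simp
qed

text \<open>Dependence of the family \<open>(D w)\<^sub>w\<close>, \<open>w \<in> F\<close>: unlike dependence of the set \<open>D ` F\<close>, it holds as soon as
  \<open>D\<close> identifies two elements of \<open>F\<close>.\<close>

definition dependent_on ::
  "('k::field \<Rightarrow> 'm::ab_group_add \<Rightarrow> 'm) \<Rightarrow> 'm set \<Rightarrow> ('m \<Rightarrow> 'm) \<Rightarrow> bool" where
  "dependent_on scale F D \<longleftrightarrow> (\<exists>u. (\<exists>w\<in>F. u w \<noteq> 0) \<and> (\<Sum>w\<in>F. scale (u w) (D w)) = 0)"

section \<open>Dependent families and their determinants\<close>

context vector_space
begin

text \<open>If \<open>D v = D w\<close> with \<open>v \<noteq> w\<close>, the coefficients 1 and -1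
  give a nontrivial relation.\<close>

lemma not_dependent_on_inj:
  assumes "finite F" "\<not> dependent_on scale F D"
  shows "inj_on D F"
proof (rule inj_onI, rule ccontr)
  fix v w assume vw: "v \<in> F" "w \<in> F" "D v = D w" "v \<noteq> w"
  define u where "u x = (if x = v then 1 else if x = w then - 1 else 0 :: 'a)" for x
  have "(\<Sum>x\<in>F. scale (u x) (D x)) = (\<Sum>x\<in>{v, w}. scale (u x) (D x))"
    using assms(1) vw by (intro sum.mono_neutral_right) (auto simp: u_def)
  also have "\<dots> = 0"
    using vw by (simp add: u_def)
  finally have "dependent_on scale F D"
    unfolding dependent_on_def using vw(1) by (intro exI[of _ u]) (auto simp: u_def)
  then show False using assms(2) by blast
qed

text \<open>By injectivity on \<open>F\<close>, a relation among the elements of the image pulls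
  back along \<open>D\<close> without merging terms.\<close>

lemma not_dependent_on_independent:
  assumes "finite F" "\<not> dependent_on scale F D"
  shows "independent (D ` F)"
proof
  assume "dependent (D ` F)"
  then obtain u where u: "\<exists>v\<in>D ` F. u v \<noteq> 0" "(\<Sum>v\<in>D ` F. scale (u v) v) = 0"
    using assms(1) by (auto simp: dependent_finite)
  then have "dependent_on scale F D"
    unfolding dependent_on_def
    by (intro exI[of _ "u \<circ> D"]) (auto simp: sum.reindex not_dependent_on_inj assms)
  then show False using assms(2) by blast
qed

text \<open>Linear dependence of the vectors \<open>D w\<close> is tested by all determinants \<open>det (f\<^sub>i (D w\<^sub>j))\<close> with
  \<open>f\<^sub>i\<close> linear functionals: independent vectors have a dual family, for which the determinant is 1.\<close>

lemma zariski_closed_dependent_on: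
  assumes "finite F"
  shows "zariski_closed (\<lambda>c D m. scale c (D m)) V {D \<in> V. dependent_on scale F D}"
proof -
  interpret VK: vector_space_pair scale "(*) :: 'a \<Rightarrow> 'a \<Rightarrow> 'a"
    by unfold_locales (auto simp: algebra_simps)
  obtain ws where ws: "distinct ws" "set ws = F"
    using finite_distinct_list[OF assms] by blast
  define r where "r = length ws"
  have bij: "bij_betw ((!) ws) {0..<r} F"
    using bij_betw_nth[OF ws(1)] ws(2) by (simp add: r_def atLeast0LessThan)
  define q where "q f D = det (mat r r (\<lambda>(i, j). f i (D (ws ! j))))" for f :: "nat \<Rightarrow> 'b \<Rightarrow> 'a" and D
  \<comment> \<open>All tuples of functionals are taken at once, as \<open>zariski_closed\<close>
    admits arbitrary families; only \<open>f 0\<close>, ..., \<open>f (r - 1)\<close> enter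
    \<open>q f\<close>.\<close>
  define P where "P = {q f | f. \<forall>i. Vector_Spaces.linear scale (*) (f i)}"
  have "P \<subseteq> polynomial_functions (\<lambda>c D m. scale c (D m)) V"
  proof
    fix p assume "p \<in> P"
    then obtain f where f: "p = q f" "\<And>i. Vector_Spaces.linear scale (*) (f i)"
      unfolding P_def by blast
    show "p \<in> polynomial_functions (\<lambda>c D m. scale c (D m)) V"
      unfolding f(1) q_def
      \<comment> \<open>For fixed \<open>i\<close> and \<open>w\<close>, the map sending
        \<open>D\<close> to \<open>f i (D w)\<close> is a linear form in \<open>D\<close>.\<close>
      by (intro polynomial_functions_det polynomial_functions.linear_form)
        (simp_all add: VK.linear_add[OF f(2)] VK.linear_scale[OF f(2)])
  qed
  moreover have "(\<forall>p\<in>P. p D = 0) \<longleftrightarrow> dependent_on scale F D" for D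
  proof
    assume "dependent_on scale F D"
    then obtain u where u: "\<exists>w\<in>F. u w \<noteq> 0" "(\<Sum>w\<in>F. scale (u w) (D w)) = 0"
      unfolding dependent_on_def by blast
    show "\<forall>p\<in>P. p D = 0"
    proof
      fix p assume "p \<in> P"
      then obtain f where f: "p = q f" "\<And>i. Vector_Spaces.linear scale (*) (f i)"
        unfolding P_def by blast
      define A where "A = mat r r (\<lambda>(i, j). f i (D (ws ! j)))"
      \<comment> \<open>The coefficients of the relation form a nonzero vector in the kernel of
        \<open>A\<close>, whatever the functionals are.\<close>
      define v where "v = vec r (\<lambda>j. u (ws ! j))"
      obtain j where "j < r" "u (ws ! j) \<noteq> 0"
        using u(1) ws(2) by (metis in_set_conv_nth r_def)
      then have "v \<noteq> 0\<^sub>v r"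
        by (auto simp: v_def dest: arg_cong[where f = "\<lambda>v. v $ j"])
      moreover have "A *\<^sub>v v = 0\<^sub>v r"
      proof (rule eq_vecI)
        fix i assume i: "i < dim_vec (0\<^sub>v r)"
        have "(A *\<^sub>v v) $ i = (\<Sum>j = 0..<r. u (ws ! j) * f i (D (ws ! j)))"
          using i by (simp add: A_def v_def scalar_prod_def mult.commute)
        also have "\<dots> = (\<Sum>w\<in>F. u w * f i (D w))"
          by (rule sum.reindex_bij_betw[OF bij])
        also have "\<dots> = f i (\<Sum>w\<in>F. scale (u w) (D w))"
          by (simp add: VK.linear_sum[OF f(2)] VK.linear_scale[OF f(2)])
        also have "\<dots> = 0"
          by (simp add: u(2) VK.linear_0[OF f(2)])
        finally show "(A *\<^sub>v v) $ i = 0\<^sub>v r $ i" using i by simp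
      qed (simp add: A_def)
      ultimately have "det A = 0"
        by (subst det_0_iff_vec_prod_zero_field[of _ r])
          (auto simp: A_def v_def intro!: exI[of _ "vec r (\<lambda>j. u (ws ! j))"])
      then show "p D = 0" by (simp add: f(1) q_def A_def)
    qed
  next
    assume vanish: "\<forall>p\<in>P. p D = 0"
    show "dependent_on scale F D"
    proof (rule ccontr)
      assume nd: "\<not> dependent_on scale F D"
      \<comment> \<open>Stated for every \<open>i\<close>, because \<open>P\<close> asks for a total
        sequence of functionals; beyond \<open>r\<close> the unspecified \<open>ws ! i\<close> does
        no harm.\<close>
      have "\<exists>g. Vector_Spaces.linear scale (*) g \<and> (\<forall>y\<in>D ` F. g y = (if y = D (ws ! i) then 1 else 0))" for i
        by (rule VK.linear_independent_extend[OF not_dependent_on_independent[OF assms nd]])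
      then obtain f where f: "\<And>i. Vector_Spaces.linear scale (*) (f i)"
        "\<And>i y. y \<in> D ` F \<Longrightarrow> f i y = (if y = D (ws ! i) then 1 else 0)"
        by metis
      have "f i (D (ws ! j)) = (if i = j then 1 else 0)" if "i < r" "j < r" for i j
      proof -
        have "ws ! i \<in> F" "ws ! j \<in> F" "ws ! i = ws ! j \<longleftrightarrow> i = j"
          using that ws by (auto simp: r_def nth_eq_iff_index_eq)
        then show ?thesis
          \<comment> \<open>Distinct indices must give distinct vectors; otherwise an off-diagonal
            entry would be 1.\<close>
          using inj_on_eq_iff[OF not_dependent_on_inj[OF assms nd], of "ws ! i" "ws ! j"]
          by (auto simp: f(2))
      qed
      then have "mat r r (\<lambda>(i, j). f i (D (ws ! j))) = 1\<^sub>m r"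
        by (intro eq_matI) auto
      then have "q f D = 1" by (simp add: q_def)
      moreover have "q f D = 0" using vanish f(1) unfolding P_def by blast
      ultimately show False by simp
    qed
  qed
  ultimately show ?thesis
    unfolding zariski_closed_def by (intro exI[of _ P]) auto
qed

text \<open>For the identity the family is \<open>F\<close> itself. As each \<open>V n\<close>
  contains the identity, this will make the closed condition attached to \<open>F\<close>
  proper.\<close>

lemma not_dependent_on_id:
  assumes "independent F" "finite F"
  shows "\<not> dependent_on scale F id"
  using assms unfolding dependent_on_def by (auto simp: dependent_finite)

text \<open>Applying \<open>D\<close> to a finite expansion of \<open>m\<close> over
  \<open>B\<close> gives a relation among the \<open>D w\<close>, nontrivial because
  \<open>m \<noteq> 0\<close>.\<close>

lemma kernel_nonzero_imp_dependent_on: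
  assumes "Vector_Spaces.linear scale scale D" "D m = 0" "m \<noteq> 0" "span B = UNIV"
  shows "\<exists>F\<in>Fpow B. dependent_on scale F D"
proof -
  interpret VV: vector_space_pair scale scale ..
  have "m \<in> span B"
    using assms(4) by simp
  then obtain F u where F: "finite F" "F \<subseteq> B" "m = (\<Sum>w\<in>F. scale (u w) w)"
    unfolding span_explicit by blast
  have "\<exists>w\<in>F. u w \<noteq> 0"
  proof (rule ccontr)
    assume "\<not> (\<exists>w\<in>F. u w \<noteq> 0)"
    then have "m = 0" unfolding F(3) by simp
    then show False using assms(3) by simp
  qed
  moreover have "(\<Sum>w\<in>F. scale (u w) (D w)) = 0"
    using arg_cong[OF F(3), of D] assms(2)
    by (simp add: VV.linear_sum[OF assms(1)] VV.linear_scale[OF assms(1)])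
  ultimately have "dependent_on scale F D" unfolding dependent_on_def by blast
  then show ?thesis using F by (auto simp: Fpow_def)
qed

text \<open>A maximal independent subset of a countable spanning set is a countable basis.\<close>

lemma countable_basis_exists:
  assumes "countable G" "span G = UNIV"
  obtains B where "countable B" "independent B" "span B = UNIV"
proof -
  obtain B where B: "B \<subseteq> G" "independent B" "G \<subseteq> span B"
    using maximal_independent_subset[of G] by blast
  have "span B = UNIV"
    using span_minimal[OF B(3)] assms(2) by auto
  then show thesis
    using that B countable_subset[OF B(1) assms(1)] by blast
qed

end

section \<open>Countable dimension of \<open>M\<close> over \<open>K\<close>\<close>

context algebra_module
begin

text \<open>Monomials in finitely many algebra generators span \<open>A\<close> over
  \<open>K\<close>; their products with finitely many module generators span
  \<open>M\<close>.\<close>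

lemma countable_spanning_set:
  assumes "finite_type \<phi>" "finitely_generated_module smul"
  obtains G where "countable G" "module.span (\<lambda>c. smul (\<phi> c)) G = UNIV"
proof -
  interpret A: vector_space "\<lambda>c a. \<phi> c * a"
    by (rule algebra_module.vector_space_over_base[OF algebra_module_self])
  interpret M: vector_space "\<lambda>c. smul (\<phi> c)" by (rule vector_space_over_base)
  obtain S where S: "finite S" "generated_subalgebra \<phi> S = UNIV"
    using assms(1) unfolding finite_type_def by blast
  obtain B where B: "finite B" "span B = UNIV"
    using assms(2) unfolding finitely_generated_module_def by blast
  \<comment> \<open>Monomials are products of words over \<open>S\<close>: closure under
    multiplication is concatenation, and countability is that of the words.\<close>
  define T where "T = prod_list ` lists S"
  have T: "1 \<in> T" "S \<subseteq> T" "\<And>x y. x \<in> T \<Longrightarrow> y \<in> T \<Longrightarrow> x * y \<in> T"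
  proof -
    show "1 \<in> T" unfolding T_def by (rule image_eqI[of _ _ "[]"]) auto
    show "S \<subseteq> T" unfolding T_def
      by (rule subsetI) (rule_tac x = "[x]" in image_eqI, auto)
    show "x * y \<in> T" if "x \<in> T" "y \<in> T" for x y
    proof -
      obtain xs ys where "x = prod_list xs" "y = prod_list ys" "xs \<in> lists S" "ys \<in> lists S"
        using \<open>x \<in> T\<close> \<open>y \<in> T\<close> unfolding T_def by blast
      then show ?thesis unfolding T_def by (intro image_eqI[of _ _ "xs @ ys"]) auto
    qed
  qed
  \<comment> \<open>Expanding first \<open>x\<close> and then \<open>y\<close> over \<open>T\<close>
    reduces this to products of two monomials.\<close>
  have mult: "x * y \<in> A.span T" if "x \<in> A.span T" "y \<in> A.span T" for x y
    using that(1)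
  proof (induction rule: A.span_induct_alt)
    case base
    show ?case by (simp add: A.span_zero)
  next
    case (step c s z)
    have "s * y \<in> A.span T"
      using that(2)
    proof (induction rule: A.span_induct_alt)
      case (step d t w)
      have "\<phi> d * (s * t) + s * w \<in> A.span T"
        using T(3)[OF \<open>s \<in> T\<close> step(1)] step(2)
        by (rule A.span_add[OF A.span_scale[OF A.span_base]])
      then show ?case by (simp add: algebra_simps)
    qed (simp add: A.span_zero)
    then have "\<phi> c * (s * y) + z * y \<in> A.span T"
      using step by (intro A.span_add A.span_scale)
    then show ?case by (simp add: algebra_simps)
  qed
  have "a \<in> generated_subalgebra \<phi> S \<Longrightarrow> a \<in> A.span T" for a
  proof (induction rule: generated_subalgebra.induct)
    case (scalar c)
    then show ?case using A.span_scale[OF A.span_base[OF T(1)], of c] by simp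
  qed (use T(2) in \<open>auto intro: A.span_base A.span_add mult\<close>)
  then have spanT: "a \<in> A.span T" for a using S(2) by blast
  define G where "G = (\<lambda>(t, b). smul t b) ` (T \<times> B)"
  \<comment> \<open>First \<open>m\<close> is expanded over \<open>B\<close> with coefficients in
    \<open>A\<close>, then each coefficient over \<open>T\<close> with coefficients in
    \<open>K\<close>.\<close>
  have "m \<in> M.span G" if "m \<in> span B" for m
    using that
  proof (induction rule: span_induct_alt)
    case (step a b m)
    have "smul a b \<in> M.span G"
      using spanT[of a]
    proof (induction rule: A.span_induct_alt)
      case (step c t z)
      have "smul t b \<in> M.span G"
        using step(1) \<open>b \<in> B\<close> by (intro M.span_base) (auto simp: G_def)
      then have "smul (\<phi> c) (smul t b) + smul z b \<in> M.span G"
        using step by (intro M.span_add M.span_scale)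
      then show ?case by (simp add: scale_left_distrib)
    qed (simp add: M.span_zero)
    then show ?case using step by (intro M.span_add)
  qed (simp add: M.span_zero)
  then have "M.span G = UNIV" using B(2) by blast
  moreover have "countable G"
    unfolding G_def T_def using S(1) B(1)
    by (intro countable_image countable_SIGMA countable_lists countable_finite)
  ultimately show thesis using that by blast
qed

end

section \<open>Very general operators are injective\<close>

theorem theorem4p18:
  fixes \<phi> :: "'k::field \<Rightarrow> 'a::idom"
    and smul :: "'a \<Rightarrow> 'm::ab_group_add \<Rightarrow> 'm"
    and N :: nat
    and V :: "nat \<Rightarrow> ('m \<Rightarrow> 'm) set"
  assumes "algebra_module smul \<phi>"
    and "uncountable (UNIV :: 'k set)"
    and "finite_type \<phi>"
    and "finitely_generated_module smul"
    and "torsion_free_module smul"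
    and "\<And>n. finite_dimensional_subspace (operator_scale \<phi> smul) (V n)"
    and "\<And>n. id \<in> V n"
    and "\<And>n. V n \<subseteq> V (Suc n)"
    and "(\<Union>n. V n) = differential_operators \<phi> smul N"
  shows "very_general (operator_scale \<phi> smul) V (\<lambda>D. {m. D m = 0} = {0}) \<and>
    (\<forall>n. \<exists>\<C>. countable \<C> \<and>
       (\<forall>C\<in>\<C>. zariski_closed (operator_scale \<phi> smul) (V n) C \<and> C \<noteq> V n) \<and>
       (\<forall>D \<in> V n - \<Union>\<C>. {m. D m = 0} = {0}))"
proof -
  interpret algebra_module smul \<phi> by fact
  let ?s = "\<lambda>c. smul (\<phi> c)"
  let ?os = "operator_scale \<phi> smul"
  interpret M: vector_space ?s by (rule vector_space_over_base)
  interpret MM: vector_space_pair ?s ?s ..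
  obtain G where "countable G" "M.span G = UNIV"
    using countable_spanning_set assms(3,4) by blast
  then obtain B where B: "countable B" "M.independent B" "M.span B = UNIV"
    using M.countable_basis_exists by blast
  define \<C> where "\<C> n = (\<lambda>F. {D \<in> V n. dependent_on ?s F D}) ` Fpow B" for n
  \<comment> \<open>One exceptional set for the whole exhaustion; its trace on \<open>V n\<close> is
    the union of the family \<open>\<C> n\<close>, which is countable since \<open>B\<close> has
    only countably many finite subsets.\<close>
  define Z where "Z = {D \<in> \<Union>n. V n. \<exists>F\<in>Fpow B. dependent_on ?s F D}"
  have countable: "countable (\<C> n)" for n
    unfolding \<C>_def by (intro countable_image countable_Fpow B(1))
  have closed: "zariski_closed ?os (V n) C \<and> C \<noteq> V n" if "C \<in> \<C> n" for C n
  proof -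
    obtain F where F: "finite F" "F \<subseteq> B" "C = {D \<in> V n. dependent_on ?s F D}"
      using \<open>C \<in> \<C> n\<close> unfolding \<C>_def Fpow_def by blast
    \<comment> \<open>The identity lies in \<open>V n\<close> but not in \<open>C\<close>, so each
      member of the family is proper on its own.\<close>
    have "id \<notin> C"
      using F M.not_dependent_on_id[of F] M.independent_mono[OF B(2)] by blast
    moreover have "?os = (\<lambda>c D m. ?s c (D m))"
      by (intro ext) (simp add: operator_scale_def)
    ultimately show ?thesis
      using M.zariski_closed_dependent_on[OF F(1), of "V n"] F(3) assms(7)[of n] by auto
  qed
  have Z: "Z \<inter> V n = \<Union>(\<C> n)" for n
    unfolding Z_def \<C>_def by auto
  have kernel: "{m. D m = 0} = {0}" if "D \<in> (\<Union>n. V n) - Z" for D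
  proof -
    have lin: "Vector_Spaces.linear ?s ?s D"
      using that assms(9) differential_operator_linear by blast
    have "m = 0" if "D m = 0" for m
      using M.kernel_nonzero_imp_dependent_on[OF lin that _ B(3)] \<open>D \<in> (\<Union>n. V n) - Z\<close>
      unfolding Z_def by blast
    moreover have "D 0 = 0" by (rule MM.linear_0[OF lin])
    ultimately show ?thesis by auto
  qed
  have cover: "countable (\<C> n) \<and> (\<forall>C\<in>\<C> n. zariski_closed ?os (V n) C \<and> C \<noteq> V n)
      \<and> Z \<inter> V n = \<Union>(\<C> n)" for n
    by (intro conjI ballI countable closed[THEN conjunct1] closed[THEN conjunct2] Z)
  then have "countable_zariski_closed ?os (V n) (Z \<inter> V n)" for n
    unfolding countable_zariski_closed_def by (intro exI[of _ "\<C> n"]) simp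
  then have "ind_zariski_closed ?os V Z"
    unfolding ind_zariski_closed_def by (auto simp: Z_def)
  moreover have "\<exists>\<C>. countable \<C> \<and> (\<forall>C\<in>\<C>. zariski_closed ?os (V n) C \<and> C \<noteq> V n)
      \<and> Z \<inter> V n = \<Union>\<C>" for n
    by (rule exI[of _ "\<C> n"]) (rule cover)
  ultimately have "very_general ?os V (\<lambda>D. {m. D m = 0} = {0})"
    unfolding very_general_def by (intro exI[of _ Z] conjI allI ballI kernel)
  moreover have "\<exists>\<C>. countable \<C> \<and> (\<forall>C\<in>\<C>. zariski_closed ?os (V n) C \<and> C \<noteq> V n)
      \<and> (\<forall>D \<in> V n - \<Union>\<C>. {m. D m = 0} = {0})" for n
  proof (intro exI[of _ "\<C> n"] conjI ballI)
    show "{m. D m = 0} = {0}" if "D \<in> V n - \<Union>(\<C> n)" for D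
      \<comment> \<open>Outside \<open>\<Union>(\<C> n)\<close> an element of \<open>V n\<close> is
        outside \<open>Z\<close>, so the same family serves the explicit form.\<close>
      by (rule kernel) (use that Z[of n] in auto)
  qed (use cover in auto)
  ultimately show ?thesis by blast
qed

end
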